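(* Let $n\in\mathbb N$, $s>0$, $\delta>0$, let $f\in\mathbb B^n_s$ and assume that $$|f_k|\ge\delta\,|k|_1^{-n}e^{-|k|_1s}\qquad\forall k\in\mathcal G^n,\ |k|_1\ge\mathtt N .$$ Then, for any $k\in\mathcal G^n$ with $|k|_1\ge\mathtt N$, $\pi_{\mathbb Zk}f$ is $2^{-40}$-cosine-like.
   Context: $\mathbb T^n=\mathbb R^n/(2\pi\mathbb Z^n)$; $|k|_1=\sum|k_j|$. $\mathbb B^n_s$ is the set of zero-average real analytic functions $f=\sum_{k\in\mathbb Z^n}f_ke^{ik\cdot x}$ on $\mathbb T^n$ with $\|f\|_s:=\sup_{k}|f_k|e^{|k|_1s}\le1$. $\mathcal G^n$ is the set of $k\in\mathbb Z^n\setminus\{0\}$ whose first non-null component is positive and with $\gcd(k_1,\dots,k_n)=1$. For $k\in\mathcal G^n$, $\pi_{\mathbb Zk}f(\theta):=\sum_{j\in\mathbb Z}f_{jk}e^{ij\theta}$. $\mathtt N=\mathtt N(\delta;n,s):=2\max\{1,\frac1s\log\frac{c_{\rm o}}{s^n\delta}\}$ with $c_{\rm o}:=2^{44}(2n/e)^n$. Let $\mathbb T_1=\{\theta\in\mathbb C:|\mathrm{Im}\,\theta|<1\}/(2\pi\mathbb Z)$. For $0<\mathtt g<1/4$, a real analytic function $G:\mathbb T_1\to\mathbb C$ is called $\mathtt g$-cosine-like if, for some $\eta>0$ and $\theta_0\in\mathbb R$, $\sup_{|\mathrm{Im}\,\theta|<1}|G(\theta)-\eta\cos(\theta+\theta_0)|\le\eta\,\mathtt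 g$. *)

theory Defs
  imports "HOL-Complex_Analysis.Complex_Analysis"
begin

text \<open>
  The dimension \<open>n\<close> is \<open>CARD('n)\<close>. Functions on the torus are functions on \<open>real ^ 'n\<close> that are
  \<open>2\<pi>\<close>-periodic in every coordinate, and Fourier modes are elements of \<open>int ^ 'n\<close>. The index type
  is linearly ordered so that one can speak of the first non-null component of a mode.
\<close>

definition torus_periodic :: "(real ^ 'n \<Rightarrow> 'b) \<Rightarrow> bool" where
  "torus_periodic f \<longleftrightarrow> (\<forall>x (m :: int ^ 'n). f (x + (\<chi> i. 2 * pi * of_int (m $ i))) = f x)"

text \<open>
  Real analyticity: near every point the function is the sum of an absolutely convergent power
  series, indexed by multi-indices.
\<close>

definition real_analytic :: "(real ^ 'n \<Rightarrow> real) \<Rightarrow> bool" where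
  "real_analytic f \<longleftrightarrow>
     (\<forall>x. \<exists>r > 0. \<exists>a :: nat ^ 'n \<Rightarrow> real. \<forall>y. (\<forall>i. \<bar>y $ i - x $ i\<bar> < r) \<longrightarrow>
        ((\<lambda>\<alpha>. a \<alpha> * (\<Prod>i\<in>UNIV. (y $ i - x $ i) ^ (\<alpha> $ i))) has_sum f y) UNIV)"

definition l1_norm :: "int ^ 'n \<Rightarrow> real" where
  "l1_norm k = (\<Sum>i\<in>UNIV. \<bar>real_of_int (k $ i)\<bar>)"

definition torus_average :: "(real ^ 'n \<Rightarrow> 'b::real_normed_vector) \<Rightarrow> 'b" where
  "torus_average f = integral (cbox 0 (\<chi> i. 2 * pi)) f /\<^sub>R (2 * pi) ^ CARD('n)"

definition fourier_coeff :: "(real ^ 'n \<Rightarrow> real) \<Rightarrow> int ^ 'n \<Rightarrow> complex" where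
  "fourier_coeff f k =
     torus_average (\<lambda>x. of_real (f x) * exp (- \<i> * of_real (\<Sum>i\<in>UNIV. of_int (k $ i) * x $ i)))"

text \<open>The supremum is taken in the extended reals, so that it is infinite for unbounded families.\<close>

definition fourier_norm :: "real \<Rightarrow> (real ^ 'n \<Rightarrow> real) \<Rightarrow> ennreal" where
  "fourier_norm s f = (SUP k. ennreal (cmod (fourier_coeff f k) * exp (l1_norm k * s)))"

definition analytic_ball :: "real \<Rightarrow> (real ^ 'n \<Rightarrow> real) set" where
  "analytic_ball s =
     {f. torus_periodic f \<and> real_analytic f \<and> torus_average f = 0 \<and> fourier_norm s f \<le> 1}"

definition generators :: "(int ^ 'n::{finite,linorder}) set" where
  "generators =
     {k. k \<noteq> 0 \<and> (\<exists>i. k $ i > 0 \<and> (\<forall>j<i. k $ j = 0)) \<and> Gcd (range (\<lambda>i. k $ i)) = 1}"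

definition c_o :: "nat \<Rightarrow> real" where
  "c_o n = 2 ^ 44 * (2 * real n / exp 1) ^ n"

definition threshold :: "real \<Rightarrow> nat \<Rightarrow> real \<Rightarrow> real" where
  "threshold \<delta> n s = 2 * max 1 (1 / s * ln (c_o n / (s ^ n * \<delta>)))"

definition strip1 :: "complex set" where
  "strip1 = {\<theta>. \<bar>Im \<theta>\<bar> < 1}"

definition proj_term :: "int ^ 'n \<Rightarrow> (real ^ 'n \<Rightarrow> real) \<Rightarrow> complex \<Rightarrow> int \<Rightarrow> complex" where
  "proj_term k f \<theta> j = fourier_coeff f (j *s k) * exp (\<i> * of_int j * \<theta>)"

definition proj :: "int ^ 'n \<Rightarrow> (real ^ 'n \<Rightarrow> real) \<Rightarrow> complex \<Rightarrow> complex" where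
  "proj k f \<theta> = (\<Sum>\<^sub>\<infinity>j. proj_term k f \<theta> j)"

text \<open>
  A real analytic function on the complex strip modulo \<open>2\<pi>\<close> is a holomorphic, \<open>2\<pi>\<close>-periodic
  function on the strip that is real on the real axis.
\<close>

definition cosine_like :: "real \<Rightarrow> (complex \<Rightarrow> complex) \<Rightarrow> bool" where
  "cosine_like g G \<longleftrightarrow>
     0 < g \<and> g < 1 / 4 \<and>
     G holomorphic_on strip1 \<and>
     (\<forall>\<theta>\<in>strip1. G (\<theta> + 2 * of_real pi) = G \<theta>) \<and>
     (\<forall>x::real. G (of_real x) \<in> \<real>) \<and>
     (\<exists>\<eta> > 0. \<exists>\<theta>\<^sub>0 :: real.
        (SUP \<theta>\<in>strip1. ennreal (cmod (G \<theta> - of_real \<eta> * cos (\<theta> + of_real \<theta>\<^sub>0))))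
          \<le> ennreal (\<eta> * g))"

end

theory Submission
  imports Defs
begin

text \<open>
  Fix a generator \<open>k\<close> beyond the threshold and put \<open>K = l1_norm k\<close>, \<open>\<epsilon> = exp (- K * s)\<close>. The
  projection onto \<open>k\<close> is the one-dimensional Fourier series with coefficients
  \<open>c j = fourier_coeff f (j *s k)\<close>. Membership in the unit ball gives \<open>\<bar>c j\<bar> \<le> \<epsilon> ^ \<bar>j\<bar>\<close>, so on the strip
  of half-width 1 the \<open>j\<close>-th term is at most \<open>(e * \<epsilon>) ^ \<bar>j\<bar>\<close>. The mean \<open>c 0\<close> vanishes, and as \<open>f\<close> is
  real the modes \<open>1\<close> and \<open>-1\<close> together form exactly the cosine of amplitude \<open>\<eta> = 2 * \<bar>c 1\<bar>\<close> and phase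
  \<open>Arg (c 1)\<close>. Hence the distance to this cosine is at most the sum over \<open>\<bar>j\<bar> \<ge> 2\<close>, which is of order
  \<open>\<epsilon>\<^sup>2\<close>, and it remains to compare \<open>\<epsilon>\<^sup>2\<close> with \<open>\<bar>c 1\<bar>\<close> (\<open>cosine_like_fourier_series\<close>).

  The threshold is made for this comparison. With \<open>t = K * s\<close> it says
  \<open>exp (t / 2) \<ge> c_o n / (s ^ n * \<delta>)\<close>; half of the decay \<open>exp (- t)\<close> thus absorbs \<open>\<delta>\<close>, and the other
  half absorbs \<open>t ^ n\<close>, because the maximum of \<open>t ^ n * exp (- t / 2)\<close> is \<open>(2 * n / e) ^ n\<close>, the
  factor of \<open>c_o\<close> next to \<open>2 ^ 44\<close>. The result is \<open>2 ^ 44 * \<epsilon> \<le> \<delta> / K ^ n\<close>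
  (\<open>decay_beyond_threshold\<close>), so that the lower bound on the coefficients becomes
  \<open>2 ^ 44 * \<epsilon>\<^sup>2 \<le> \<bar>c 1\<bar>\<close>. Combined with the upper bound \<open>\<bar>c 1\<bar> \<le> \<epsilon>\<close> this also yields
  \<open>\<epsilon> \<le> 2 ^ -44\<close>: the geometric ratio \<open>e * \<epsilon>\<close> is small however small \<open>s\<close> is. The remaining factor
  \<open>2 ^ 4\<close> covers \<open>e\<^sup>2\<close> and the sum of the geometric series.
\<close>

section \<open>Geometric series over the integers\<close>

lemma has_sum_two_sided_geometric:
  fixes q :: real
  assumes "0 \<le> q" "q < 1" "0 < m"
  shows "((\<lambda>j::int. q ^ nat \<bar>j\<bar>) has_sum 2 * q ^ m / (1 - q)) {j. int m \<le> \<bar>j\<bar>}"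
proof -
  have "(\<lambda>i. q ^ (m + i)) sums (q ^ m / (1 - q))"
    using sums_mult[OF geometric_sums, of q "q ^ m"] assms by (simp add: power_add)
  moreover from this have "summable (\<lambda>i. norm (q ^ (m + i)))"
    using assms(1) by (simp add: sums_iff)
  ultimately have tail: "((\<lambda>i. q ^ (m + i)) has_sum q ^ m / (1 - q)) UNIV"
    by (rule norm_summable_imp_has_sum[rotated])
  have pos: "((\<lambda>j::int. q ^ nat \<bar>j\<bar>) has_sum q ^ m / (1 - q)) {int m..}"
    using tail
    by (subst has_sum_reindex_bij_witness[of _ "\<lambda>i. int (m + i)" "\<lambda>j. nat j - m"
          UNIV "\<lambda>i. q ^ (m + i)"])
       (auto simp: nat_add_distrib)
  have neg: "((\<lambda>j::int. q ^ nat \<bar>j\<bar>) has_sum q ^ m / (1 - q)) {..- int m}"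
    using pos
    by (subst has_sum_reindex_bij_witness[of _ uminus uminus "{int m..}" "\<lambda>j. q ^ nat \<bar>j\<bar>"]) auto
  have "{int m..} \<inter> {..- int m} = {}" and "{int m..} \<union> {..- int m} = {j. int m \<le> \<bar>j\<bar>}"
    using assms(3) by auto
  with has_sum_Un_disjoint[OF pos neg] show ?thesis by simp
qed

lemma summable_two_sided_geometric:
  fixes q :: real
  assumes "0 \<le> q" "q < 1"
  shows "(\<lambda>j::int. q ^ nat \<bar>j\<bar>) summable_on UNIV"
proof -
  have "(\<lambda>j::int. q ^ nat \<bar>j\<bar>) summable_on {j. int 1 \<le> \<bar>j\<bar>}"
    using has_sum_two_sided_geometric[OF assms zero_less_one] by (rule has_sum_imp_summable)
  then have "(\<lambda>j::int. q ^ nat \<bar>j\<bar>) summable_on insert 0 {j. int 1 \<le> \<bar>j\<bar>}"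
    by (simp only: summable_on_insert_iff)
  moreover have "insert 0 {j. int 1 \<le> \<bar>j\<bar>} = UNIV" by auto
  ultimately show ?thesis by simp
qed

section \<open>Fourier series dominated by their first mode\<close>

lemma norm_exp_strip_le:
  assumes "\<theta> \<in> strip1"
  shows "cmod (exp (\<i> * of_int j * \<theta>)) \<le> exp \<bar>of_int j\<bar>"
proof -
  have "- (of_int j * Im \<theta>) \<le> \<bar>of_int j\<bar> * \<bar>Im \<theta>\<bar>"
    by (metis abs_ge_minus_self abs_mult)
  also have "\<dots> \<le> \<bar>of_int j\<bar> * 1"
    using assms by (intro mult_left_mono) (auto simp: strip1_def)
  finally show ?thesis by simp
qed

lemma open_strip1: "open strip1"
  unfolding strip1_def by (intro open_Collect_less continuous_intros)

text \<open>
  Two conjugate modes make up a single cosine, for complex \<open>\<theta>\<close> too: modulus and argument of the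
  coefficient turn into amplitude and phase.
\<close>

lemma conjugate_modes_eq_cos:
  "z * exp (\<i> * \<theta>) + cnj z * exp (- (\<i> * \<theta>)) =
     of_real (2 * cmod z) * cos (\<theta> + of_real (Arg z))"
proof -
  have z: "z = of_real (cmod z) * exp (\<i> * of_real (Arg z))"
    by (cases "z = 0") (auto simp: Arg_eq)
  have "cnj z = of_real (cmod z) * exp (- (\<i> * of_real (Arg z)))"
    by (subst z) (simp add: exp_cnj)
  then have "z * exp (\<i> * \<theta>) + cnj z * exp (- (\<i> * \<theta>)) =
      of_real (cmod z) * (exp (\<i> * of_real (Arg z)) * exp (\<i> * \<theta>) +
        exp (- (\<i> * of_real (Arg z))) * exp (- (\<i> * \<theta>)))"
    by (subst z) (simp add: algebra_simps)
  then show ?thesis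
    by (simp add: cos_exp_eq ring_distribs add.commute flip: exp_add)
qed

text \<open>
  Unordered sums are limits along the filter of finite subsets and not along a sequence, whence
  the arbitrary filter.
\<close>

lemma holomorphic_on_uniform_limit:
  assumes lim: "uniform_limit S f g F" and F: "F \<noteq> bot" and S: "open S"
    and holo: "\<forall>\<^sub>F n in F. f n holomorphic_on S"
  shows "g holomorphic_on S"
proof -
  have "g field_differentiable (at z)" if z: "z \<in> S" for z
  proof -
    obtain r where r: "0 < r" "cball z r \<subseteq> S"
      using S z by (meson open_contains_cball)
    have "\<forall>\<^sub>F n in F. continuous_on (cball z r) (f n) \<and> f n holomorphic_on ball z r"
      using holo
    proof eventually_elim
      case (elim n)
      then have "f n holomorphic_on cball z r" "f n holomorphic_on ball z r"
        using r(2) ball_subset_cball by (blast intro: holomorphic_on_subset)+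
      then show ?case by (simp add: holomorphic_on_imp_continuous_on)
    qed
    then have "g holomorphic_on ball z r"
      using holomorphic_uniform_limit uniform_limit_on_subset[OF lim r(2)] F by blast
    then show ?thesis
      using r(1) by (intro holomorphic_on_imp_differentiable_at[of g "ball z r"]) auto
  qed
  then show ?thesis
    by (simp add: S holomorphic_on_open field_differentiable_def)
qed

text \<open>
  The geometric majorant of the terms serves twice. By the Weierstrass test the series converges
  uniformly on the strip, which gives holomorphy; and its part \<open>\<bar>j\<bar> \<ge> 2\<close>, of sum
  \<open>2 * q\<^sup>2 / (1 - q)\<close>, bounds the distance to the cosine formed by the modes \<open>1\<close> and \<open>-1\<close>. The
  factor \<open>2\<close> cancels against the one in the amplitude \<open>2 * cmod (c 1)\<close>.
\<close>

lemma cosine_like_fourier_series: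
  fixes c :: "int \<Rightarrow> complex" and q g :: real
  assumes c0: "c 0 = 0" and cnj: "\<And>j. c (- j) = cnj (c j)" and c1: "c 1 \<noteq> 0"
    and q: "0 \<le> q" "q < 1"
    and decay: "\<And>j. cmod (c j) * exp \<bar>of_int j\<bar> \<le> q ^ nat \<bar>j\<bar>"
    and g: "0 < g" "g < 1 / 4"
    and tail: "q\<^sup>2 / (1 - q) \<le> cmod (c 1) * g"
  shows "\<theta> \<in> strip1 \<Longrightarrow> (\<lambda>j. c j * exp (\<i> * of_int j * \<theta>)) summable_on UNIV"
    and "cosine_like g (\<lambda>\<theta>. \<Sum>\<^sub>\<infinity>j. c j * exp (\<i> * of_int j * \<theta>))"
proof -
  define T where "T = (\<lambda>j \<theta>. c j * exp (\<i> * of_int j * \<theta>))"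
  define G where "G = (\<lambda>\<theta>. \<Sum>\<^sub>\<infinity>j. T j \<theta>)"
  have T_le: "cmod (T j \<theta>) \<le> q ^ nat \<bar>j\<bar>" if "\<theta> \<in> strip1" for j \<theta>
  proof -
    have "cmod (T j \<theta>) \<le> cmod (c j) * exp \<bar>of_int j\<bar>"
      unfolding T_def norm_mult by (intro mult_left_mono norm_exp_strip_le that) auto
    with decay[of j] show ?thesis by linarith
  qed
  have summable: "(\<lambda>j. T j \<theta>) summable_on A" if "\<theta> \<in> strip1" for \<theta> A
  proof -
    have "(\<lambda>j. cmod (T j \<theta>)) summable_on UNIV"
      using summable_two_sided_geometric[OF q] T_le[OF that]
      by (rule Infinite_Sum.abs_summable_on_comparison_test')
    then show ?thesis
      by (rule summable_on_subset_banach[OF abs_summable_summable subset_UNIV])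
  qed
  from summable[of \<theta> UNIV] show "\<theta> \<in> strip1 \<Longrightarrow> (\<lambda>j. c j * exp (\<i> * of_int j * \<theta>)) summable_on UNIV"
    by (simp add: T_def)
  have "uniform_limit strip1 (\<lambda>X \<theta>. \<Sum>j\<in>X. T j \<theta>) G (finite_subsets_at_top UNIV)"
    unfolding G_def using T_le summable_two_sided_geometric[OF q]
    by (intro Weierstrass_m_test_general) auto
  then have holo: "G holomorphic_on strip1"
    by (rule holomorphic_on_uniform_limit)
       (auto simp: T_def open_strip1 intro!: always_eventually holomorphic_intros)
  have period: "G (\<theta> + 2 * of_real pi) = G \<theta>" for \<theta>
  proof -
    have "exp (\<i> * of_int j * (\<theta> + 2 * of_real pi)) = exp (\<i> * of_int j * \<theta>)" for j
      using exp_plus_2pin[of "\<i> * of_int j * \<theta>" j] by (simp add: algebra_simps)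
    then show ?thesis by (simp add: G_def T_def)
  qed
  have real: "G (of_real x) \<in> \<real>" for x
  proof -
    have "cnj (G (of_real x)) = (\<Sum>\<^sub>\<infinity>j. T (- j) (of_real x))"
      by (simp add: G_def T_def cnj exp_cnj flip: infsum_cnj)
    also have "\<dots> = G (of_real x)"
      unfolding G_def by (rule infsum_reindex_bij_betw[of uminus]) (rule bij_uminus)
    finally show ?thesis by (simp add: Reals_cnj_iff)
  qed
  have close: "cmod (G \<theta> - of_real (2 * cmod (c 1)) * cos (\<theta> + of_real (Arg (c 1))))
      \<le> 2 * cmod (c 1) * g" if \<theta>: "\<theta> \<in> strip1" for \<theta>
  proof -
    have split: "UNIV = {-1, 0, 1} \<union> {j::int. int 2 \<le> \<bar>j\<bar>}" by auto
    have "G \<theta> = (\<Sum>\<^sub>\<infinity>j\<in>{-1, 0, 1}. T j \<theta>) + (\<Sum>\<^sub>\<infinity>j\<in>{j. int 2 \<le> \<bar>j\<bar>}. T j \<theta>)"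
      unfolding G_def by (subst split, rule infsum_Un_disjoint) (auto intro: summable[OF \<theta>])
    also have "(\<Sum>\<^sub>\<infinity>j\<in>{-1, 0, 1}. T j \<theta>) =
        of_real (2 * cmod (c 1)) * cos (\<theta> + of_real (Arg (c 1)))"
      using conjugate_modes_eq_cos[of "c 1" \<theta>] by (simp add: T_def c0 cnj add.commute)
    finally have "G \<theta> - of_real (2 * cmod (c 1)) * cos (\<theta> + of_real (Arg (c 1))) =
        (\<Sum>\<^sub>\<infinity>j\<in>{j. int 2 \<le> \<bar>j\<bar>}. T j \<theta>)" by simp
    also have "cmod \<dots> \<le> 2 * q\<^sup>2 / (1 - q)"
      using has_sum_infsum[OF summable[OF \<theta>]] has_sum_two_sided_geometric[OF q, of 2] T_le[OF \<theta>]
      by (rule norm_infsum_le) auto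
    finally show ?thesis using tail by simp
  qed
  have "cosine_like g G"
    unfolding cosine_like_def
  proof (intro conjI ballI allI)
    show "\<exists>\<eta>>0. \<exists>\<theta>\<^sub>0::real. (SUP \<theta>\<in>strip1.
        ennreal (cmod (G \<theta> - of_real \<eta> * cos (\<theta> + of_real \<theta>\<^sub>0)))) \<le> ennreal (\<eta> * g)"
      using c1 close
      by (intro exI[of _ "2 * cmod (c 1)"] conjI exI[of _ "Arg (c 1)"] SUP_least ennreal_leI) auto
  qed (use g holo period real in auto)
  then show "cosine_like g (\<lambda>\<theta>. \<Sum>\<^sub>\<infinity>j. c j * exp (\<i> * of_int j * \<theta>))"
    by (simp add: G_def T_def)
qed

section \<open>Fourier coefficients on the torus\<close>

lemma fourier_coeff_uminus: "fourier_coeff f (- k) = cnj (fourier_coeff f k)"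
proof -
  show ?thesis
    by (simp add: fourier_coeff_def torus_average_def integral_cnj sum_negf exp_cnj)
qed

lemma fourier_coeff_0_eq_torus_average: "fourier_coeff f 0 = of_real (torus_average f)"
proof -
  let ?B = "cbox 0 (\<chi> i. 2 * pi) :: (real ^ 'a) set"
  have "integral ?B (\<lambda>x. complex_of_real (f x)) = of_real (integral ?B f)"
  proof (cases "f integrable_on ?B")
    case True
    then show ?thesis
      using integral_linear[OF True bounded_linear_of_real] by (simp add: o_def)
  next
    case False
    then have "\<not> (\<lambda>x. complex_of_real (f x)) integrable_on ?B"
      using integrable_linear[OF _ bounded_linear_Re] by (fastforce simp: o_def)
    with False show ?thesis by (simp add: not_integrable_integral)
  qed
  then show ?thesis
    by (simp add: fourier_coeff_def torus_average_def scaleR_conv_of_real)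
qed

lemma norm_fourier_coeff_le:
  assumes "fourier_norm s f \<le> 1"
  shows "cmod (fourier_coeff f k) \<le> exp (- l1_norm k * s)"
proof -
  have "ennreal (cmod (fourier_coeff f k) * exp (l1_norm k * s)) \<le> ennreal 1"
    using assms unfolding fourier_norm_def by (simp add: SUP_le_iff)
  then have "cmod (fourier_coeff f k) * exp (l1_norm k * s) \<le> 1"
    by (subst (asm) ennreal_le_iff) auto
  then show ?thesis by (simp add: exp_minus field_simps)
qed

lemma l1_norm_smult: "l1_norm (j *s k) = \<bar>of_int j\<bar> * l1_norm k"
  by (simp add: l1_norm_def abs_mult sum_distrib_left)

section \<open>Decay beyond the threshold\<close>

text \<open>
  The maximum of \<open>t ^ n * exp (- t / 2)\<close> is attained at \<open>t = 2 * n\<close>. The bound is the \<open>n\<close>-th power of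
  the tangent line inequality \<open>x \<le> exp (x - 1)\<close> at \<open>x = t / (2 * n)\<close>.
\<close>

lemma power_le_exp_half:
  assumes "0 < n" "0 \<le> t"
  shows "t ^ n \<le> (2 * real n / exp 1) ^ n * exp (t / 2)"
proof -
  have "t / (2 * n) \<le> exp (t / (2 * n) - 1)"
    using exp_ge_add_one_self[of "t / (2 * n) - 1"] by simp
  also have "\<dots> = exp (t / (2 * n)) / exp 1"
    by (rule exp_diff)
  finally have "t \<le> 2 * real n / exp 1 * exp (t / (2 * n))"
    using assms(1) by (simp add: field_simps)
  then have "t ^ n \<le> (2 * real n / exp 1 * exp (t / (2 * n))) ^ n"
    using assms by (intro power_mono)
  also have "\<dots> = (2 * real n / exp 1) ^ n * exp (t / 2)"
    using assms(1) exp_of_nat_mult[of n "t / (2 * real n)"]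
    by (simp only: power_mult_distrib) simp
  finally show ?thesis .
qed

text \<open>
  The factor \<open>exp (K * s)\<close> is spent in two halves: one bounds \<open>(K * s) ^ n\<close> in terms of \<open>c_o n\<close>, the
  other bounds \<open>c_o n\<close> in terms of \<open>\<delta>\<close> by the definition of the threshold. The powers of \<open>s\<close> cancel.
\<close>

lemma decay_beyond_threshold:
  assumes "0 < n" "0 < s" "0 < \<delta>" "threshold \<delta> n s \<le> K"
  shows "2 ^ 44 * exp (- K * s) \<le> \<delta> / K ^ n"
proof -
  have K: "2 \<le> K" "2 * (1 / s * ln (c_o n / (s ^ n * \<delta>))) \<le> K"
    using assms(4) unfolding threshold_def by (auto simp: max_def split: if_splits)
  have "0 < c_o n" using assms(1) by (simp add: c_o_def)
  have "ln (c_o n / (s ^ n * \<delta>)) \<le> K * s / 2"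
    using K(2) assms(2) by (simp add: field_simps)
  then have "c_o n / (s ^ n * \<delta>) \<le> exp (K * s / 2)"
    using \<open>0 < c_o n\<close> assms by (metis ln_ge_iff ln_le_cancel_iff exp_gt_zero ln_exp divide_pos_pos mult_pos_pos zero_less_power)
  then have co: "c_o n \<le> s ^ n * \<delta> * exp (K * s / 2)"
    using assms by (simp add: field_simps)
  have "2 ^ 44 * (K * s) ^ n \<le> 2 ^ 44 * ((2 * real n / exp 1) ^ n * exp (K * s / 2))"
    using power_le_exp_half[of n "K * s"] assms K(1) by simp
  also have "\<dots> = c_o n * exp (K * s / 2)" by (simp add: c_o_def)
  also have "\<dots> \<le> s ^ n * \<delta> * exp (K * s / 2) * exp (K * s / 2)"
    using co by (intro mult_right_mono) auto
  also have "\<dots> = s ^ n * \<delta> * exp (K * s)" by (simp flip: exp_add)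
  finally have "2 ^ 44 * K ^ n \<le> \<delta> * exp (K * s)"
    using assms by (simp add: power_mult_distrib)
  then show ?thesis using K(1) by (simp add: exp_minus field_simps)
qed

section \<open>Projections of generic functions are cosine-like\<close>

theorem proposition1p1:
  fixes f :: "real ^ 'n::{finite,linorder} \<Rightarrow> real" and s \<delta> :: real
  assumes "s > 0" and "\<delta> > 0"
    and "f \<in> analytic_ball s"
    and "\<And>k. k \<in> generators \<Longrightarrow> l1_norm k \<ge> threshold \<delta> CARD('n) s \<Longrightarrow>
           cmod (fourier_coeff f k) \<ge> \<delta> / l1_norm k ^ CARD('n) * exp (- l1_norm k * s)"
  shows "\<forall>k\<in>generators. l1_norm k \<ge> threshold \<delta> CARD('n) s \<longrightarrow>
           (\<forall>\<theta>\<in>strip1. proj_term k f \<theta> summable_on UNIV) \<and>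
           cosine_like (1 / 2 ^ 40) (proj k f)"
proof (intro ballI impI)
  fix k :: "int ^ 'n::{finite,linorder}"
  assume k: "k \<in> generators" "threshold \<delta> CARD('n) s \<le> l1_norm k"
  define c where "c = (\<lambda>j. fourier_coeff f (j *s k))"
  define \<epsilon> where "\<epsilon> = exp (- l1_norm k * s)"
  have "0 < \<epsilon>" by (simp add: \<epsilon>_def)
  have ball: "torus_average f = 0" "fourier_norm s f \<le> 1"
    using assms(3) by (auto simp: analytic_ball_def)
  have c0: "c 0 = 0"
    using ball(1) fourier_coeff_0_eq_torus_average[of f] by (simp add: c_def)
  have cnj: "c (- j) = cnj (c j)" for j
    by (simp add: c_def vector_smult_lneg flip: fourier_coeff_uminus)
  have c_le: "cmod (c j) \<le> \<epsilon> ^ nat \<bar>j\<bar>" for j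
  proof -
    have "exp (- l1_norm (j *s k) * s) = \<epsilon> ^ nat \<bar>j\<bar>"
      unfolding \<epsilon>_def by (simp add: l1_norm_smult mult.assoc flip: exp_of_nat_mult)
    then show ?thesis
      unfolding c_def using norm_fourier_coeff_le[OF ball(2), of "j *s k"] by simp
  qed
  have "2 ^ 44 * \<epsilon> * \<epsilon> \<le> \<delta> / l1_norm k ^ CARD('n) * \<epsilon>"
    using decay_beyond_threshold[OF _ assms(1,2) k(2)] \<open>0 < \<epsilon>\<close>
    unfolding \<epsilon>_def by (intro mult_right_mono) auto
  also have "\<dots> \<le> cmod (c 1)"
    using assms(4)[OF k] by (simp add: c_def \<epsilon>_def)
  finally have c1: "2 ^ 44 * \<epsilon> * \<epsilon> \<le> cmod (c 1)" .
  \<comment> \<open>The lower bound on \<open>c 1\<close> must not exceed the upper bound \<open>\<epsilon>\<close>; this forces \<open>\<epsilon>\<close> to be small.\<close>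
  have "2 ^ 44 * \<epsilon> * \<epsilon> \<le> 1 * \<epsilon>"
    using c1 c_le[of 1] by simp
  then have \<epsilon>_le: "2 ^ 44 * \<epsilon> \<le> 1"
    using \<open>0 < \<epsilon>\<close> by (simp only: mult_le_cancel_right)
  have q: "0 \<le> exp 1 * \<epsilon>" "exp 1 * \<epsilon> \<le> 3 * \<epsilon>"
    using \<open>0 < \<epsilon>\<close> exp_le by auto
  have q_half: "exp 1 * \<epsilon> \<le> 1 / 4" using q \<epsilon>_le by simp
  have decay: "cmod (c j) * exp \<bar>of_int j\<bar> \<le> (exp 1 * \<epsilon>) ^ nat \<bar>j\<bar>" for j
  proof -
    have "exp \<bar>real_of_int j\<bar> = exp 1 ^ nat \<bar>j\<bar>"
      by (simp flip: exp_of_nat_mult)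
    then show ?thesis
      using c_le[of j] by (simp add: power_mult_distrib)
  qed
  have tail: "(exp 1 * \<epsilon>)\<^sup>2 / (1 - exp 1 * \<epsilon>) \<le> cmod (c 1) * (1 / 2 ^ 40)"
  proof -
    have "(exp 1 * \<epsilon>)\<^sup>2 \<le> (3 * \<epsilon>)\<^sup>2" using q by (intro power_mono)
    \<comment> \<open>\<open>9 \<le> 2 ^ 4 * (3 / 4)\<close>, where \<open>3 / 4\<close> is a lower bound for \<open>1 - exp 1 * \<epsilon>\<close>\<close>
    also have "\<dots> \<le> (2 ^ 4 * \<epsilon> * \<epsilon>) * (3 / 4)"
      by (simp add: power2_eq_square)
    also have "\<dots> \<le> (cmod (c 1) * (1 / 2 ^ 40)) * (1 - exp 1 * \<epsilon>)"
    proof (rule mult_mono)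
      show "2 ^ 4 * \<epsilon> * \<epsilon> \<le> cmod (c 1) * (1 / 2 ^ 40)" using c1 by simp
    qed (use q_half in auto)
    finally show ?thesis using q_half by (simp add: pos_divide_le_eq)
  qed
  have "0 < cmod (c 1)"
    using \<open>0 < \<epsilon>\<close> by (intro less_le_trans[OF _ c1]) simp
  then have "c 1 \<noteq> 0" by simp
  then have "(\<forall>\<theta>\<in>strip1. (\<lambda>j. c j * exp (\<i> * of_int j * \<theta>)) summable_on UNIV) \<and>
      cosine_like (1 / 2 ^ 40) (\<lambda>\<theta>. \<Sum>\<^sub>\<infinity>j. c j * exp (\<i> * of_int j * \<theta>))"
    using cosine_like_fourier_series[OF c0 cnj _ q(1) _ decay _ _ tail] q_half by auto
  then show "(\<forall>\<theta>\<in>strip1. proj_term k f \<theta> summable_on UNIV) \<and> cosine_like (1 / 2 ^ 40) (proj k f)"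
    unfolding c_def proj_def[abs_def] proj_term_def[abs_def] .
qed

end
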